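(* For the single-machine scheduling problem with uniform linear deterioration and release times, any $\rho$-approximation algorithm for minimizing the makespan is $\left(1+\frac{1}{\beta}\right)\rho$-approximate for minimizing the sum of completion times $\sum_{i\in\mathcal{J}}C_i$.
   Context: Problem: a single machine must process a set $\mathcal{J}=\{1,\ldots,n\}$ of jobs non-preemptively, at most one job at a time. Job $i$ has a release time $r_i\ge 0$ and a fixed processing time $\alpha_i\ge 0$, and there is a common deterioration rate $\beta>0$. If job $i$ starts at time $s_i\ge r_i$, its processing time is $p_i(s_i)=\alpha_i+\beta s_i$, so it completes at $C_i=(1+\beta)s_i+\alpha_i$. A schedule is feasible if jobs do not overlap and $s_i\ge r_i$ for all $i$. The makespan is $\max_i C_i$ and the total completion time is $\sum_i C_i$. An algorithm is $\rho$-approximate for an objective if on every instance it returns a feasible schedule whose objective value is at most $\rho$ times the optimal objective value. *)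

theory Defs
  imports Complex_Main
begin

text \<open>
  The fields \<open>release\<close> and \<open>alpha\<close> are relevant only on the job indices \<open>1, \<dots>, num_jobs\<close>.
  The deterioration rate \<open>\<beta>\<close> is a parameter of the problem and not a field of the instance;
  an algorithm that also receives \<open>\<beta>\<close> as input yields one algorithm for each value of \<open>\<beta>\<close>.
\<close>

record sched_instance =
  num_jobs :: nat
  release :: "nat \<Rightarrow> real"
  alpha :: "nat \<Rightarrow> real"

definition jobs :: "sched_instance \<Rightarrow> nat set" where
  "jobs I = {1..num_jobs I}"

definition valid_instance :: "sched_instance \<Rightarrow> bool" where
  "valid_instance I \<longleftrightarrow>
     num_jobs I \<ge> 1 \<and> (\<forall>i\<in>jobs I. release I i \<ge> 0 \<and> alpha I i \<ge> 0)"

text \<open>A schedule assigns to each job its start time.\<close>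

type_synonym schedule = "nat \<Rightarrow> real"

definition processing :: "real \<Rightarrow> sched_instance \<Rightarrow> schedule \<Rightarrow> nat \<Rightarrow> real" where
  "processing \<beta> I s i = alpha I i + \<beta> * s i"

definition completion :: "real \<Rightarrow> sched_instance \<Rightarrow> schedule \<Rightarrow> nat \<Rightarrow> real" where
  "completion \<beta> I s i = s i + processing \<beta> I s i"

text \<open>
  A job has processing time zero only if it starts at time 0 with \<open>alpha I i = 0\<close>, so
  the pairwise condition below is the same as requiring the processing intervals to have
  disjoint interiors.
\<close>

definition feasible :: "real \<Rightarrow> sched_instance \<Rightarrow> schedule \<Rightarrow> bool" where
  "feasible \<beta> I s \<longleftrightarrow>
     (\<forall>i\<in>jobs I. s i \<ge> release I i) \<and>
     (\<forall>i\<in>jobs I. \<forall>j\<in>jobs I. i \<noteq> j \<longrightarrow>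
        completion \<beta> I s i \<le> s j \<or> completion \<beta> I s j \<le> s i)"

type_synonym objective = "real \<Rightarrow> sched_instance \<Rightarrow> schedule \<Rightarrow> real"

definition makespan :: objective where
  "makespan \<beta> I s = Max (completion \<beta> I s ` jobs I)"

definition total_completion_time :: objective where
  "total_completion_time \<beta> I s = (\<Sum>i\<in>jobs I. completion \<beta> I s i)"

definition opt_value :: "objective \<Rightarrow> real \<Rightarrow> sched_instance \<Rightarrow> real" where
  "opt_value obj \<beta> I = Inf (obj \<beta> I ` {s. feasible \<beta> I s})"

text \<open>
  An algorithm is represented by its input-output function; no computability or running-time
  requirement is imposed.
\<close>

definition approximation_algorithm ::
  "objective \<Rightarrow> real \<Rightarrow> real \<Rightarrow> (sched_instance \<Rightarrow> schedule) \<Rightarrow> bool" where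
  "approximation_algorithm obj \<beta> \<rho> A \<longleftrightarrow>
     (\<forall>I. valid_instance I \<longrightarrow>
        feasible \<beta> I (A I) \<and> obj \<beta> I (A I) \<le> \<rho> * opt_value obj \<beta> I)"

end

theory Submission
  imports Defs
begin

text \<open>
  When job \<open>j\<close> runs after job \<open>i\<close>, it starts no earlier than \<open>C i\<close>, so \<open>C j \<ge> (1 + \<beta>) * C i\<close>:
  completion times grow geometrically, and on every schedule their sum is at most
  \<open>1 + 1 / \<beta>\<close> times the makespan. Conversely, the makespan is at most the total completion time
  of the same schedule, and so the optimal values compare in the same way.
\<close>

text \<open>Elements are added in increasing order of \<open>f\<close>, so the newest
  \<open>x\<close> has the largest value and separation bounds the earlier values by
  \<open>f x / (1 + \<beta>)\<close>. That smaller bound replaces \<open>M\<close> in the induction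
  hypothesis, which is why \<open>M\<close> is generalized.\<close>

lemma sum_le_of_geometric_separation:
  fixes f :: "'a \<Rightarrow> real"
  assumes "finite S" "\<beta> > 0" "M \<ge> 0"
    and "\<And>i. i \<in> S \<Longrightarrow> 0 \<le> f i \<and> f i \<le> M"
    and "\<And>i j. i \<in> S \<Longrightarrow> j \<in> S \<Longrightarrow> i \<noteq> j \<Longrightarrow> (1 + \<beta>) * f i \<le> f j \<or> (1 + \<beta>) * f j \<le> f i"
  shows "sum f S \<le> (1 + 1 / \<beta>) * M"
  using assms
proof (induction S arbitrary: M rule: finite_ranking_induct[where f = f])
  case empty
  then show ?case by simp
next
  case (insert x S)
  show ?case
  \<comment> \<open>The ranking induction rule does not provide \<open>x \<notin> S\<close>.\<close>
  proof (cases "x \<in> S")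
    case True
    then show ?thesis using insert by (simp add: insert_absorb)
  next
    case False
    have fx: "0 \<le> f x" "f x \<le> M" using insert.prems by auto
    have "0 \<le> f i \<and> f i \<le> f x / (1 + \<beta>)" if "i \<in> S" for i
    proof -
      have i: "0 \<le> f i" "f i \<le> f x" using that insert by auto
      have "(1 + \<beta>) * f i \<le> f x"
      \<comment> \<open>Since \<open>f i \<le> f x\<close>, separation in the reverse direction is
        possible only when both values are 0, and then the claim is trivial.\<close>
      proof (cases "(1 + \<beta>) * f x \<le> f i")
        case True
        then have "\<beta> * f x \<le> 0" using i by (simp add: distrib_right)
        then have "f x = 0" using fx \<open>\<beta> > 0\<close> by (simp add: mult_le_0_iff)
        then show ?thesis using i by simp
      next
        case False
        then show ?thesis using insert.prems(4)[of i x] that \<open>x \<notin> S\<close> by auto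
      qed
      then show ?thesis using i \<open>\<beta> > 0\<close> by (simp add: field_simps)
    qed
    \<comment> \<open>As \<open>1 + 1 / \<beta>\<close> equals
      \<open>(1 + \<beta>) / \<beta>\<close>, the factor \<open>1 + \<beta>\<close> cancels; adding
      \<open>f x\<close> to the remaining \<open>f x / \<beta>\<close> restores the same
      constant.\<close>
    then have "sum f S \<le> (1 + 1 / \<beta>) * (f x / (1 + \<beta>))"
      using insert.prems fx by (intro insert.IH) auto
    also have "\<dots> = f x / \<beta>" using \<open>\<beta> > 0\<close> by (simp add: divide_simps)
    finally have "sum f (insert x S) \<le> (1 + 1 / \<beta>) * f x"
      using False insert.hyps by (simp add: algebra_simps)
    also have "\<dots> \<le> (1 + 1 / \<beta>) * M"
      using fx \<open>\<beta> > 0\<close> by (intro mult_left_mono) auto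
    finally show ?thesis .
  qed
qed

lemma finite_jobs [simp]: "finite (jobs I)"
  by (simp add: jobs_def)

lemma jobs_nonempty: "valid_instance I \<Longrightarrow> jobs I \<noteq> {}"
  by (simp add: valid_instance_def jobs_def)

lemma completion_eq: "completion \<beta> I s i = (1 + \<beta>) * s i + alpha I i"
  by (simp add: completion_def processing_def algebra_simps)

context
  fixes \<beta> :: real and I :: sched_instance and s :: schedule
  assumes \<beta>: "\<beta> > 0" and valid: "valid_instance I" and feas: "feasible \<beta> I s"
begin

lemma completion_nonneg:
  assumes "i \<in> jobs I"
  shows "0 \<le> completion \<beta> I s i"
proof -
  have "0 \<le> s i" "0 \<le> alpha I i"
    using assms valid feas by (force simp: valid_instance_def feasible_def)+
  then show ?thesis using \<beta> by (simp add: completion_eq)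
qed

lemma completion_le_makespan:
  "i \<in> jobs I \<Longrightarrow> completion \<beta> I s i \<le> makespan \<beta> I s"
  by (simp add: makespan_def)

lemma makespan_nonneg: "0 \<le> makespan \<beta> I s"
  using jobs_nonempty[OF valid] completion_nonneg completion_le_makespan
  by (meson all_not_in_conv order_trans)

lemma completion_separation:
  assumes "i \<in> jobs I" "j \<in> jobs I" "i \<noteq> j"
  shows "(1 + \<beta>) * completion \<beta> I s i \<le> completion \<beta> I s j \<or>
         (1 + \<beta>) * completion \<beta> I s j \<le> completion \<beta> I s i"
proof -
  \<comment> \<open>Here \<open>t\<close> stands for the completion time of whichever job comes
    first.\<close>
  have *: "(1 + \<beta>) * t \<le> completion \<beta> I s k" if "t \<le> s k" "k \<in> jobs I" for t k
  proof -
    have "(1 + \<beta>) * t \<le> (1 + \<beta>) * s k" using that \<beta> by (intro mult_left_mono) auto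
    moreover have "0 \<le> alpha I k" using that valid by (simp add: valid_instance_def)
    ultimately show ?thesis by (simp add: completion_eq)
  qed
  have "completion \<beta> I s i \<le> s j \<or> completion \<beta> I s j \<le> s i"
    using assms feas by (simp add: feasible_def)
  then show ?thesis using *[of _ i] *[of _ j] assms by blast
qed

lemma total_completion_time_le_makespan:
  "total_completion_time \<beta> I s \<le> (1 + 1 / \<beta>) * makespan \<beta> I s"
  unfolding total_completion_time_def
  by (rule sum_le_of_geometric_separation)
    (use \<beta> makespan_nonneg completion_nonneg completion_le_makespan completion_separation in auto)

lemma makespan_le_total_completion_time:
  "makespan \<beta> I s \<le> total_completion_time \<beta> I s"
  unfolding makespan_def total_completion_time_def
  using jobs_nonempty[OF valid] completion_nonneg
  by (auto intro!: Max.boundedI member_le_sum)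

end

text \<open>Each schedule is its own witness in the comparison of infima. The schedule
  \<open>s\<close> serves only to make the feasible set nonempty, as infima of reals
  require.\<close>

lemma opt_makespan_le_opt_total_completion_time:
  assumes \<beta>: "\<beta> > 0" and valid: "valid_instance I" and feas: "feasible \<beta> I s"
  shows "opt_value makespan \<beta> I \<le> opt_value total_completion_time \<beta> I"
  unfolding opt_value_def
proof (rule cINF_mono)
  show "{s. feasible \<beta> I s} \<noteq> {}" using feas by blast
  show "bdd_below (makespan \<beta> I ` {s. feasible \<beta> I s})"
    using makespan_nonneg[OF \<beta> valid] by (auto intro!: bdd_belowI2[of _ 0])
  show "\<exists>t\<in>{s. feasible \<beta> I s}. makespan \<beta> I t \<le> total_completion_time \<beta> I u"
    if "u \<in> {s. feasible \<beta> I s}" for u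
    using that makespan_le_total_completion_time[OF \<beta> valid] by blast
qed

text \<open>
  A negative ratio is excluded by an instance with a positive optimal value; the sign is needed
  to multiply the comparison of optimal values by \<open>\<rho>\<close>.
\<close>

lemma makespan_approximation_ratio_nonneg:
  assumes "\<beta> > 0" "approximation_algorithm makespan \<beta> \<rho> A"
  shows "0 \<le> \<rho>"
proof -
  \<comment> \<open>A single job of fixed processing time 1 completes no earlier than time 1, so
    both the optimum and the value attained by \<open>A\<close> are at least 1.\<close>
  define I where "I = \<lparr>num_jobs = 1, release = \<lambda>_. 0, alpha = \<lambda>_. 1\<rparr>"
  have valid: "valid_instance I" by (simp add: I_def valid_instance_def)
  have jobs: "jobs I = {1}" by (simp add: I_def jobs_def)
  have ge: "1 \<le> makespan \<beta> I s" if "feasible \<beta> I s" for s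
  proof -
    have "0 \<le> s 1" using that by (simp add: feasible_def jobs) (simp add: I_def)
    then have "1 \<le> completion \<beta> I s 1" using assms(1) by (simp add: completion_eq I_def)
    then show ?thesis by (simp add: makespan_def jobs)
  qed
  have A: "feasible \<beta> I (A I)" "makespan \<beta> I (A I) \<le> \<rho> * opt_value makespan \<beta> I"
    using assms(2) valid by (auto simp: approximation_algorithm_def)
  have "1 \<le> opt_value makespan \<beta> I"
    unfolding opt_value_def using A(1) ge by (intro cINF_greatest) auto
  moreover have "0 < \<rho> * opt_value makespan \<beta> I" using ge[OF A(1)] A(2) by linarith
  ultimately show ?thesis by (simp add: zero_less_mult_iff)
qed

theorem theorem17:
  fixes \<beta> \<rho> :: real and A :: "sched_instance \<Rightarrow> schedule"
  assumes "\<beta> > 0"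
    and "approximation_algorithm makespan \<beta> \<rho> A"
  shows "approximation_algorithm total_completion_time \<beta> ((1 + 1 / \<beta>) * \<rho>) A"
  unfolding approximation_algorithm_def
proof (intro allI impI conjI)
  fix I assume valid: "valid_instance I"
  show feas: "feasible \<beta> I (A I)"
    using assms(2) valid by (simp add: approximation_algorithm_def)
  have "makespan \<beta> I (A I) \<le> \<rho> * opt_value makespan \<beta> I"
    using assms(2) valid by (simp add: approximation_algorithm_def)
  also have "\<dots> \<le> \<rho> * opt_value total_completion_time \<beta> I"
    \<comment> \<open>The output \<open>A I\<close> itself shows that a feasible schedule
      exists.\<close>
    using opt_makespan_le_opt_total_completion_time[OF assms(1) valid feas]
      makespan_approximation_ratio_nonneg[OF assms] by (rule mult_left_mono)
  finally have "(1 + 1 / \<beta>) * makespan \<beta> I (A I)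
      \<le> (1 + 1 / \<beta>) * (\<rho> * opt_value total_completion_time \<beta> I)"
    using assms(1) by (intro mult_left_mono) auto
  with total_completion_time_le_makespan[OF assms(1) valid feas]
  show "total_completion_time \<beta> I (A I)
      \<le> (1 + 1 / \<beta>) * \<rho> * opt_value total_completion_time \<beta> I"
    by (simp add: mult.assoc)
qed

end
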